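(* Let $j^{\operatorname{last}}_{m,k}(312)$ be the number of $312$-avoiding Jacobi permutations $\pi\in\mathfrak{S}_m$ whose last letter equals $k$. For all $n\geq k\geq1$, \[ j^{\operatorname{last}}_{2n,2k-1}(312)=\frac{\binom{3k-3}{k-1}\binom{3n-3k+1}{n-k+1}}{(2k-1)(2n-2k+1)}\qquad\text{and}\qquad j^{\operatorname{last}}_{2n+1,2k}(312)=\frac{\binom{3k-2}{k}\binom{3n-3k+1}{n-k+1}}{(2k-1)(2n-2k+1)}. \] In addition, $j^{\operatorname{last}}_{2n+1,1}(312)=\frac{1}{2n+1}\binom{3n}{n}$ for all $n\geq0$, and, for $k\neq1$, $j^{\operatorname{last}}_{n,k}(312)=0$ whenever $n$ and $k$ have the same parity.
   Context: A permutation of a finite set $S$ of positive integers is a word in which each element of $S$ appears exactly once; $\mathfrak{S}_m$ is the set of permutations of $\{1,\dots,m\}$. For a permutation $\pi$ and a letter $x$ of $\pi$, $\rho_\pi(x)$ is the maximal consecutive subword of $\pi$ consisting of the letters immediately to the right of $x$ that are all larger than $x$. $\pi$ is Jacobi if $|\rho_\pi(x)|$ is even for all letters $x$. A permutation $\pi$ avoids a pattern $\sigma$ if no subword of $\pi$ has standardization (relative order) $\sigma$. *)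

theory Defs
  imports Complex_Main "HOL-Library.Sublist" "HOL-Combinatorics.Multiset_Permutations"
begin

text \<open>
  Permutations are words without repeated letters, i.e. distinct lists of natural numbers;
  the permutations of \<open>{1, \<dots>, m}\<close> are the elements of \<^term>\<open>permutations_of_set {1..m::nat}\<close>.
\<close>

definition rho :: "nat list \<Rightarrow> nat \<Rightarrow> nat list" where
  "rho w x = takeWhile (\<lambda>y. x < y) (tl (dropWhile (\<lambda>y. y \<noteq> x) w))"

definition jacobi :: "nat list \<Rightarrow> bool" where
  "jacobi w \<longleftrightarrow> (\<forall>x\<in>set w. even (length (rho w x)))"

definition standardization :: "nat list \<Rightarrow> nat list" where
  "standardization w = map (\<lambda>x. card {y \<in> set w. y \<le> x}) w"

text \<open>Subwords in the sense of pattern avoidance need not be consecutive.\<close>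

definition avoids :: "nat list \<Rightarrow> nat list \<Rightarrow> bool" where
  "avoids w p \<longleftrightarrow> \<not> (\<exists>v. subseq v w \<and> standardization v = p)"

text \<open>The empty word has no last letter, so it is excluded explicitly.\<close>

definition jlast :: "nat list \<Rightarrow> nat \<Rightarrow> nat \<Rightarrow> nat" where
  "jlast p m k =
     card {w \<in> permutations_of_set {1..m}. jacobi w \<and> avoids w p \<and> w \<noteq> [] \<and> last w = k}"

end

theory Submission
  imports Defs "HOL-Computational_Algebra.Formal_Power_Series"
begin

text \<open>
  If a \<open>312\<close>-avoiding word ends in \<open>k\<close>, then its letters below \<open>k\<close> precede those above \<open>k\<close>, so
  it has the form \<open>u v k\<close> with \<open>u < k < v\<close>. It is Jacobi iff \<open>u\<close> and \<open>v\<close> are Jacobi and either \<open>u\<close> is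
  empty or the length of \<open>v\<close> is odd. Hence the number of these words is \<open>J(k - 1) J(m - k)\<close>, where
  \<open>J\<close> counts all \<open>312\<close>-avoiding Jacobi permutations of a given size, or zero. Summing over \<open>k\<close>, the
  series \<open>E = \<Sum> J(2n) z\<^sup>n\<close> and \<open>F = \<Sum> J(2n + 1) z\<^sup>n\<close> satisfy \<open>E = 1 + z E F\<close> and
  \<open>F = E + z F\<^sup>2\<close>, whence \<open>F = E\<^sup>2\<close> and \<open>E = 1 + z E\<^sup>3\<close>. Two differential equations that follow
  from this make the ratios of consecutive values of \<open>J\<close> rational, which gives the closed forms.
\<close>

section \<open>Invariance under increasing relabelling\<close>

lemma rho_map:
  assumes "strict_mono f"
  shows "rho (map f w) (f x) = map f (rho w x)"
proof -
  have "inj f" using assms by (rule strict_mono_imp_inj_on)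
  have 1: "(\<lambda>y. y \<noteq> f x) \<circ> f = (\<lambda>y. y \<noteq> x)" using \<open>inj f\<close> by (auto simp: fun_eq_iff inj_eq)
  have 2: "(\<lambda>y. f x < y) \<circ> f = (\<lambda>y. x < y)"
    using assms by (auto simp: fun_eq_iff strict_mono_less)
  show ?thesis unfolding rho_def by (simp add: dropWhile_map takeWhile_map 1 2 flip: map_tl)
qed

lemma jacobi_map: "strict_mono f \<Longrightarrow> jacobi (map f w) \<longleftrightarrow> jacobi w"
  unfolding jacobi_def by (simp add: rho_map)

lemma standardization_map:
  assumes "strict_mono f"
  shows "standardization (map f v) = standardization v"
proof -
  have "{y \<in> f ` set v. y \<le> f x} = f ` {y \<in> set v. y \<le> x}" for x
    using assms by (auto simp: strict_mono_less_eq)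
  moreover have "card (f ` A) = card A" for A
    by (rule card_image[OF strict_mono_imp_inj_on[OF assms]])
  ultimately show ?thesis unfolding standardization_def by simp
qed

text \<open>Taking a subword means choosing a set of positions, which commutes with relabelling the
  letters, and an increasing relabelling keeps all relative ranks.\<close>

lemma avoids_map:
  assumes "strict_mono f"
  shows "avoids (map f w) p \<longleftrightarrow> avoids w p"
proof -
  have "(\<exists>v. subseq v (map f w) \<and> standardization v = p) \<longleftrightarrow>
        (\<exists>v. subseq v w \<and> standardization v = p)"
    unfolding subseq_conv_nths
    by (metis nths_map standardization_map[OF assms])
  then show ?thesis unfolding avoids_def by simp
qed

section \<open>The pattern 312 and concatenation\<close>

lemma standardization_eq_312_iff:
  "standardization v = [3, 1, 2] \<longleftrightarrow> (\<exists>a b c. v = [a, b, c] \<and> b < c \<and> c < a)"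
proof
  assume std: "standardization v = [3, 1, 2]"
  then have "length v = 3" unfolding standardization_def by (metis length_map length_Cons list.size(3) numeral_3_eq_3)
  then obtain a b c where v: "v = [a, b, c]"
    by (auto simp: numeral_3_eq_3 length_Suc_conv)
  define r where "r x = card {y \<in> set v. y \<le> x}" for x
  have r: "r a = 3" "r b = 1" "r c = 2"
    using std unfolding standardization_def r_def v by simp_all
  have mono: "r x \<le> r y" if "x \<le> y" for x y
    unfolding r_def by (rule card_mono) (use that in auto)
  \<comment> \<open>Ranks are weakly increasing in the letter, so a strictly larger rank forces a
    strictly larger letter.\<close>
  have "b < c" "c < a"
    using mono[of c b] mono[of a c] r by (auto simp: not_le[symmetric])
  with v show "\<exists>a b c. v = [a, b, c] \<and> b < c \<and> c < a" by blast
next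
  assume "\<exists>a b c. v = [a, b, c] \<and> b < c \<and> c < a"
  then obtain a b c where v: "v = [a, b, c]" "b < c" "c < a" by blast
  then have "{y \<in> set v. y \<le> a} = {a, b, c}" "{y \<in> set v. y \<le> b} = {b}"
    "{y \<in> set v. y \<le> c} = {b, c}" by auto
  with v show "standardization v = [3, 1, 2]" unfolding standardization_def by simp
qed

lemma avoids_312_iff:
  "avoids w [3, 1, 2] \<longleftrightarrow> (\<forall>a b c. subseq [a, b, c] w \<longrightarrow> \<not> (b < c \<and> c < a))"
  unfolding avoids_def standardization_eq_312_iff by blast

lemma avoids_subseq: "avoids w p \<Longrightarrow> subseq v w \<Longrightarrow> avoids v p"
  unfolding avoids_def using subseq_order.trans by blast

lemma subseq_imp_set_subset: "subseq v w \<Longrightarrow> set v \<subseteq> set w"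
  unfolding subseq_conv_nths using set_nths_subset by fastforce

text \<open>An occurrence of 312 across the cut would have its first letter in \<open>u\<close> and
  its last in \<open>v\<close>, but the first letter of a 312 exceeds the last.\<close>

lemma avoids_312_append_iff:
  assumes "\<And>x y. x \<in> set u \<Longrightarrow> y \<in> set v \<Longrightarrow> x < y"
  shows "avoids (u @ v) [3, 1, 2] \<longleftrightarrow> avoids u [3, 1, 2] \<and> avoids v [3, 1, 2]"
proof
  assume "avoids (u @ v) [3, 1, 2]"
  then show "avoids u [3, 1, 2] \<and> avoids v [3, 1, 2]"
    by (auto elim: avoids_subseq)
next
  assume uv: "avoids u [3, 1, 2] \<and> avoids v [3, 1, 2]"
  show "avoids (u @ v) [3, 1, 2]"
    unfolding avoids_312_iff
  proof (intro allI impI notI)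
    fix a b c assume "subseq [a, b, c] (u @ v)" and lt: "b < c \<and> c < a"
    then obtain s t where st: "[a, b, c] = s @ t" "subseq s u" "subseq t v"
      by (auto simp: subseq_append_iff)
    have "s = [a, b, c] \<or> t = [a, b, c] \<or> a \<in> set s \<and> c \<in> set t"
      using st(1) by (auto simp: Cons_eq_append_conv)
    moreover have "s \<noteq> [a, b, c]" "t \<noteq> [a, b, c]"
      using uv st lt unfolding avoids_312_iff by blast+
    moreover have "a < c" if "a \<in> set s" "c \<in> set t"
      by (rule assms) (use that st(2,3) in \<open>auto dest: subseq_imp_set_subset\<close>)
    ultimately show False using lt by auto
  qed
qed

text \<open>As a final letter \<open>k\<close> could only play the 2 of a 312, and then the letter
  playing the 1 would lie in \<open>u\<close> below \<open>k\<close>.\<close>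

lemma avoids_312_snoc_iff:
  assumes "\<And>x. x \<in> set u \<Longrightarrow> k < x"
  shows "avoids (u @ [k]) [3, 1, 2] \<longleftrightarrow> avoids u [3, 1, 2]"
proof
  assume "avoids (u @ [k]) [3, 1, 2]"
  then show "avoids u [3, 1, 2]" by (auto elim: avoids_subseq)
next
  assume u: "avoids u [3, 1, 2]"
  show "avoids (u @ [k]) [3, 1, 2]"
    unfolding avoids_312_iff
  proof (intro allI impI notI)
    fix a b c assume "subseq [a, b, c] (u @ [k])" and lt: "b < c \<and> c < a"
    then obtain s t where st: "[a, b, c] = s @ t" "subseq s u" "subseq t [k]"
      by (auto simp: subseq_append_iff)
    from st(3) have "t = [] \<or> t = [k]"
      by (cases t) (auto split: if_splits)
    then show False
    proof
      assume "t = []"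
      then show False using st u lt unfolding avoids_312_iff by auto
    next
      assume t: "t = [k]"
      then have s: "s = [a, b]" "c = k" using st(1) by (auto simp: Cons_eq_append_conv)
      then have "b \<in> set u" using st(2) by (auto dest: subseq_imp_set_subset)
      then show False using assms lt s by force
    qed
  qed
qed

section \<open>The Jacobi condition and concatenation\<close>

lemma rho_append_left:
  assumes "x \<in> set u"
  shows "rho (u @ v) x = (if \<forall>y\<in>set (tl (dropWhile (\<lambda>y. y \<noteq> x) u)). x < y
           then rho u x @ takeWhile (\<lambda>y. x < y) v else rho u x)"
proof -
  have ne: "dropWhile (\<lambda>y. y \<noteq> x) u \<noteq> []" using assms by auto
  have "dropWhile (\<lambda>y. y \<noteq> x) (u @ v) = dropWhile (\<lambda>y. y \<noteq> x) u @ v"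
    using assms by (auto simp: dropWhile_append)
  then show ?thesis
    unfolding rho_def using ne by (simp add: takeWhile_append takeWhile_eq_all_conv[THEN iffD2])
qed

lemma rho_append_right: "x \<notin> set u \<Longrightarrow> rho (u @ v) x = rho v x"
  unfolding rho_def by (simp add: dropWhile_append)

text \<open>A final letter below all others prolongs no run of larger letters, and its own run is
  empty.\<close>

lemma jacobi_snoc_iff:
  assumes "\<And>x. x \<in> set u \<Longrightarrow> k < x"
  shows "jacobi (u @ [k]) \<longleftrightarrow> jacobi u"
proof -
  have "rho (u @ [k]) x = rho u x" if "x \<in> set u" for x
    using assms[OF that] by (simp add: rho_append_left[OF that])
  moreover have "rho (u @ [k]) k = []"
    using assms by (subst rho_append_right) (auto simp: rho_def)
  ultimately show ?thesis unfolding jacobi_def by auto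
qed

text \<open>The last letter of \<open>u\<close> is followed only by larger letters, so its parity condition
  is the parity of the length of \<open>v\<close>.\<close>

lemma jacobi_append_iff:
  assumes lt: "\<And>x y. x \<in> set u \<Longrightarrow> y \<in> set v \<Longrightarrow> x < y" and dist: "distinct u"
  shows "jacobi (u @ v) \<longleftrightarrow> jacobi u \<and> jacobi v \<and> (u = [] \<or> even (length v))"
proof (cases "u = []")
  case True
  then show ?thesis by (simp add: jacobi_def)
next
  case False
  have v: "rho (u @ v) x = rho v x" if "x \<in> set v" for x
    using lt that by (intro rho_append_right) blast
  have tw: "takeWhile (\<lambda>y. x < y) v = v" if "x \<in> set u" for x
    using lt that by simp
  \<comment> \<open>Appending \<open>v\<close> prolongs the run of \<open>x\<close> either not at
    all or by the whole of \<open>v\<close>, so an even \<open>v\<close> changes no parity.\<close>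
  have u: "even (length (rho (u @ v) x)) \<longleftrightarrow> even (length (rho u x))"
    if "x \<in> set u" "even (length v)" for x
    using that by (simp add: rho_append_left tw)
  obtain u' l where l: "u = u' @ [l]" using False by (metis rev_exhaust)
  have "l \<notin> set u'" using dist l by simp
  then have "rho (u @ v) l = takeWhile (\<lambda>y. l < y) v"
    unfolding l append_assoc by (subst rho_append_right) (auto simp: rho_def)
  then have last: "rho (u @ v) l = v" using tw[of l] l by simp
  have "l \<in> set u" using l by simp
  have "even (length v)" if "jacobi (u @ v)"
    using that last \<open>l \<in> set u\<close> unfolding jacobi_def by force
  moreover have "jacobi (u @ v) \<longleftrightarrow> jacobi u \<and> jacobi v" if "even (length v)"
    unfolding jacobi_def set_append ball_Un using u[OF _ that] by (simp add: v)
  ultimately show ?thesis using False by blast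
qed

section \<open>Decomposition by the last letter\<close>

text \<open>The alphabet is a parameter because the block of letters above \<open>k\<close> is a
  word over \<open>{k + 1..m}\<close>.\<close>

definition jacobi_av312 :: "nat set \<Rightarrow> nat list set" where
  "jacobi_av312 A = {w \<in> permutations_of_set A. jacobi w \<and> avoids w [3, 1, 2]}"

definition num_jacobi_av312 :: "nat \<Rightarrow> nat" where
  "num_jacobi_av312 m = card (jacobi_av312 {1..m})"

lemma num_jacobi_av312_0: "num_jacobi_av312 0 = 1"
proof -
  have "jacobi_av312 {1..0} = {[]}"
    by (auto simp: jacobi_av312_def jacobi_def avoids_312_iff simp del: One_nat_def)
  then show ?thesis by (simp add: num_jacobi_av312_def)
qed

lemma jacobi_av312_shift: "jacobi_av312 ((\<lambda>x. x + k) ` A) = map (\<lambda>x. x + k) ` jacobi_av312 A"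
proof -
  have mono: "strict_mono (\<lambda>x::nat. x + k)" by (simp add: strict_mono_def)
  have "permutations_of_set ((\<lambda>x. x + k) ` A) = map (\<lambda>x. x + k) ` permutations_of_set A"
    by (rule permutations_of_set_image_inj) simp
  then show ?thesis
    unfolding jacobi_av312_def by (auto simp: jacobi_map[OF mono] avoids_map[OF mono])
qed

text \<open>Shifting all letters by \<open>k\<close> preserves both conditions, so only the size of
  the interval matters.\<close>

lemma card_jacobi_av312_interval:
  assumes "k \<le> m" shows "card (jacobi_av312 {k + 1..m}) = num_jacobi_av312 (m - k)"
proof -
  have "{k + 1..m} = (\<lambda>x. x + k) ` {1..m - k}"
    using assms by (simp add: image_add_atLeastAtMost')
  moreover have "inj_on (map (\<lambda>x. x + k)) B" for B
    by (rule inj_on_subset[OF inj_mapI]) (auto intro: injI)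
  ultimately show ?thesis
    unfolding num_jacobi_av312_def by (simp only: jacobi_av312_shift card_image)
qed

text \<open>Cut before the first letter c above \<open>k\<close>. A letter x below \<open>k\<close>
  after c would make c, x, \<open>k\<close> a 312.\<close>

lemma avoids_312_snoc_split:
  assumes av: "avoids (u @ [k]) [3, 1, 2]" and k: "k \<notin> set u"
  obtains v w where "u = v @ w" "\<And>x. x \<in> set v \<Longrightarrow> x < k" "\<And>x. x \<in> set w \<Longrightarrow> k < x"
proof
  let ?w = "dropWhile (\<lambda>x. x < k) u"
  show "u = takeWhile (\<lambda>x. x < k) u @ ?w" by simp
  show "x < k" if "x \<in> set (takeWhile (\<lambda>x. x < k) u)" for x
    using that by (auto dest: set_takeWhileD)
  show "k < x" if x: "x \<in> set ?w" for x
  proof (rule ccontr)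
    assume "\<not> k < x"
    moreover have xu: "x \<in> set u" using x by (auto dest: set_dropWhileD)
    ultimately have xk: "x < k" using k by (metis nat_neq_iff)
    obtain c cs where c: "?w = c # cs" using x by (cases ?w) auto
    then have "\<not> c < k" using hd_dropWhile[of "\<lambda>x. x < k" u] by auto
    moreover have "c \<in> set u" using c by (metis list.set_intros(1) set_dropWhileD)
    ultimately have ck: "k < c" using k by (metis nat_neq_iff)
    then have "x \<in> set cs" using x c xk by auto
    then have "subseq [c, x] ?w" using c by (simp add: subseq_singleton_left)
    then have "subseq [c, x] u"
      by (metis list_emb_append2 takeWhile_dropWhile_id)
    then have "subseq ([c, x] @ [k]) (u @ [k])" by (rule list_emb_append_mono) simp
    then show False using av xk ck unfolding avoids_312_iff by auto
  qed
qed

text \<open>The block following \<open>u\<close> is \<open>v @ [k]\<close>, of length m - k + 1. It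
  must be even unless \<open>u\<close> is empty, hence the parity of m - k and the exception k =
  1.\<close>

lemma jlast_312_set_eq:
  assumes k: "1 \<le> k" "k \<le> m"
  shows "{w \<in> permutations_of_set {1..m}. jacobi w \<and> avoids w [3, 1, 2] \<and> w \<noteq> [] \<and> last w = k} =
    (if k = 1 \<or> odd (m - k)
     then (\<lambda>(u, v). u @ v @ [k]) ` (jacobi_av312 {1..k - 1} \<times> jacobi_av312 {k + 1..m}) else {})"
    (is "?L = ?R")
proof (intro equalityI subsetI)
  fix w assume "w \<in> ?L"
  then have w: "set w = {1..m}" "distinct w" "jacobi w" "avoids w [3, 1, 2]" "w \<noteq> []" "last w = k"
    by (auto simp: permutations_of_set_def)
  define t where "t = butlast w"
  have wt: "w = t @ [k]" using w by (metis append_butlast_last_id t_def)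
  have "k \<notin> set t" using w(2) wt by auto
  with w(4) wt obtain u v where uv: "t = u @ v"
    "\<And>x. x \<in> set u \<Longrightarrow> x < k" "\<And>x. x \<in> set v \<Longrightarrow> k < x"
    by (metis avoids_312_snoc_split)
  have st: "set u \<union> set v \<union> {k} = {1..m}" using w(1) wt uv by auto
  have su: "set u = {1..k - 1}"
  proof (intro equalityI subsetI)
    fix x assume "x \<in> set u"
    then show "x \<in> {1..k - 1}" using st uv(2)[of x] by auto
  next
    fix x assume "x \<in> {1..k - 1}"
    then have "x < k" "x \<in> {1..m}" using k by auto
    then show "x \<in> set u" unfolding st[symmetric] using uv(3)[of x] by auto
  qed
  have sv: "set v = {k + 1..m}"
  proof (intro equalityI subsetI)
    fix x assume "x \<in> set v"
    then show "x \<in> {k + 1..m}" using st uv(3)[of x] by auto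
  next
    fix x assume "x \<in> {k + 1..m}"
    then have "k < x" "x \<in> {1..m}" using k by auto
    then show "x \<in> set v" unfolding st[symmetric] using uv(2)[of x] by auto
  qed
  have d: "distinct u" "distinct v" using w(2) wt uv(1) by auto
  have lt: "x < y" if "x \<in> set u" "y \<in> set (v @ [k])" for x y
    using that uv(2,3) by force
  have "length v = m - k" using d(2) sv by (metis distinct_card card_atLeastAtMost diff_Suc_Suc Suc_eq_plus1)
  moreover have "u = [] \<longleftrightarrow> k = 1" using su k by (cases "u = []") auto
  ultimately have "jacobi u" "jacobi v" "k = 1 \<or> odd (m - k)"
    using w(3) wt uv(1) jacobi_append_iff[of u "v @ [k]", OF lt d(1)] jacobi_snoc_iff[of v k, OF uv(3)]
    by auto
  moreover have "avoids u [3, 1, 2]" "avoids v [3, 1, 2]"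
    using w(4) wt uv(1) avoids_312_append_iff[of u "v @ [k]", OF lt] avoids_312_snoc_iff[of v k, OF uv(3)]
    by auto
  ultimately show "w \<in> ?R"
    using su sv d wt uv(1) by (auto simp: jacobi_av312_def permutations_of_set_def)
next
  fix w assume "w \<in> ?R"
  then obtain u v where par: "k = 1 \<or> odd (m - k)" and w: "w = u @ v @ [k]"
    and u: "set u = {1..k - 1}" "distinct u" "jacobi u" "avoids u [3, 1, 2]"
    and v: "set v = {k + 1..m}" "distinct v" "jacobi v" "avoids v [3, 1, 2]"
    by (auto simp: jacobi_av312_def permutations_of_set_def split: if_splits)
  have ltv: "k < x" if "x \<in> set v" for x using that v by auto
  have lt: "x < y" if "x \<in> set u" "y \<in> set (v @ [k])" for x y
    using that u(1) v(1) by force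
  have "length v = m - k" using v by (metis distinct_card card_atLeastAtMost diff_Suc_Suc Suc_eq_plus1)
  moreover have "k = 1 \<Longrightarrow> u = []" using u by auto
  ultimately have "jacobi w"
    using par u v jacobi_append_iff[of u "v @ [k]", OF lt u(2)] jacobi_snoc_iff[of v k, OF ltv]
    unfolding w by auto
  moreover have "avoids w [3, 1, 2]"
    using u v avoids_312_append_iff[of u "v @ [k]", OF lt] avoids_312_snoc_iff[of v k, OF ltv]
    unfolding w by auto
  moreover have "set w = {1..m}" "distinct w" using u v k unfolding w by auto
  ultimately show "w \<in> ?L" unfolding w by (auto simp: permutations_of_set_def)
qed

lemma jlast_312:
  "jlast [3, 1, 2] m k =
    (if 1 \<le> k \<and> k \<le> m \<and> (k = 1 \<or> odd (m - k))
     then num_jacobi_av312 (k - 1) * num_jacobi_av312 (m - k) else 0)"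
proof (cases "1 \<le> k \<and> k \<le> m")
  case True
  \<comment> \<open>All words \<open>u\<close> have the same length k - 1, so the place of the cut
    is known.\<close>
  have "inj_on (\<lambda>(u, v). u @ v @ [k]) (jacobi_av312 {1..k - 1} \<times> jacobi_av312 {k + 1..m})"
  proof (rule inj_onI, clarify)
    fix u v u' v'
    assume "u \<in> jacobi_av312 {1..k - 1}" "u' \<in> jacobi_av312 {1..k - 1}"
    then have "length u = length u'"
      by (metis (no_types, lifting) jacobi_av312_def length_finite_permutations_of_set mem_Collect_eq)
    moreover assume "u @ v @ [k] = u' @ v' @ [k]"
    ultimately show "u = u' \<and> v = v'" by simp
  qed
  with True show ?thesis
    unfolding jlast_def jlast_312_set_eq[OF conjunct1[OF True] conjunct2[OF True]]
    by (auto simp: card_image card_cartesian_product card_jacobi_av312_interval[of k m]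
      num_jacobi_av312_def[symmetric] simp del: One_nat_def)
next
  case False
  have "{w \<in> permutations_of_set {1..m}. jacobi w \<and> avoids w [3, 1, 2] \<and> w \<noteq> [] \<and> last w = k} = {}"
  proof (rule equals0I)
    fix w assume "w \<in> {w \<in> permutations_of_set {1..m}. jacobi w \<and> avoids w [3, 1, 2] \<and> w \<noteq> [] \<and> last w = k}"
    then have "k \<in> {1..m}" using last_in_set[of w] by (auto simp: permutations_of_set_def)
    then show False using False by simp
  qed
  then show ?thesis using False by (auto simp: jlast_def)
qed

section \<open>Convolution recurrences\<close>

text \<open>Words are sorted by last letter; \<open>m > 0\<close> excludes the empty word, which
  \<open>num_jacobi_av312\<close> counts but which has no last letter.\<close>

lemma num_jacobi_av312_eq_sum_jlast:
  assumes "m > 0"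
  shows "num_jacobi_av312 m = (\<Sum>k=1..m. jlast [3, 1, 2] m k)"
proof -
  have "jacobi_av312 {1..m} = (\<Union>k\<in>{1..m}.
      {w \<in> permutations_of_set {1..m}. jacobi w \<and> avoids w [3, 1, 2] \<and> w \<noteq> [] \<and> last w = k})"
  proof (intro equalityI subsetI)
    fix w assume w: "w \<in> jacobi_av312 {1..m}"
    then have "set w = {1..m}" by (simp add: jacobi_av312_def permutations_of_set_def)
    moreover from this have "w \<noteq> []" using assms by auto
    ultimately have "w \<noteq> []" "last w \<in> {1..m}" using last_in_set by auto
    with w show "w \<in> (\<Union>k\<in>{1..m}.
      {w \<in> permutations_of_set {1..m}. jacobi w \<and> avoids w [3, 1, 2] \<and> w \<noteq> [] \<and> last w = k})"
      unfolding jacobi_av312_def by blast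
  qed (auto simp: jacobi_av312_def)
  then show ?thesis
    unfolding num_jacobi_av312_def jlast_def
    by (simp only:) (rule card_UN_disjoint, auto)
qed

text \<open>For even m only odd last letters k = 2i + 1 survive, and the exceptional k = 1 is
  already among them.\<close>

lemma num_jacobi_av312_even:
  "num_jacobi_av312 (2 * n + 2) =
    (\<Sum>i=0..n. num_jacobi_av312 (2 * i) * num_jacobi_av312 (2 * (n - i) + 1))"
proof -
  let ?f = "jlast [3, 1, 2] (2 * n + 2)"
  have "num_jacobi_av312 (2 * n + 2) = (\<Sum>k=1..2 * n + 2. ?f k)"
    by (rule num_jacobi_av312_eq_sum_jlast) simp
  also have "\<dots> = (\<Sum>k\<in>(\<lambda>i. 2 * i + 1) ` {0..n}. ?f k)"
  proof (rule sum.mono_neutral_right)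
    show "\<forall>k\<in>{1..2 * n + 2} - (\<lambda>i. 2 * i + 1) ` {0..n}. ?f k = 0"
    proof
      fix k assume k: "k \<in> {1..2 * n + 2} - (\<lambda>i. 2 * i + 1) ` {0..n}"
      have "even k"
      proof (rule ccontr)
        assume "odd k"
        then obtain i where "k = 2 * i + 1" by (auto elim: oddE)
        with k show False by auto
      qed
      then show "?f k = 0" using k by (auto simp: jlast_312 simp del: One_nat_def)
    qed
  qed auto
  also have "\<dots> = (\<Sum>i=0..n. ?f (2 * i + 1))"
    by (subst sum.reindex) (auto simp: inj_on_def)
  also have "\<dots> = (\<Sum>i=0..n. num_jacobi_av312 (2 * i) * num_jacobi_av312 (2 * (n - i) + 1))"
  proof (rule sum.cong)
    fix i assume "i \<in> {0..n}"
    then have "2 * n + 2 - (2 * i + 1) = 2 * (n - i) + 1" by auto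
    then show "?f (2 * i + 1) = num_jacobi_av312 (2 * i) * num_jacobi_av312 (2 * (n - i) + 1)"
      using \<open>i \<in> {0..n}\<close> by (simp add: jlast_312 del: One_nat_def)
  qed simp
  finally show ?thesis .
qed

text \<open>For odd m the even last letters k = 2i + 2 give the convolution. The exceptional k = 1
  now has the wrong parity and adds the separate term J(0) J(2n + 2).\<close>

lemma num_jacobi_av312_odd:
  "num_jacobi_av312 (2 * n + 3) = num_jacobi_av312 (2 * n + 2) +
    (\<Sum>i=0..n. num_jacobi_av312 (2 * i + 1) * num_jacobi_av312 (2 * (n - i) + 1))"
proof -
  let ?f = "jlast [3, 1, 2] (2 * n + 3)"
  have "num_jacobi_av312 (2 * n + 3) = (\<Sum>k=1..2 * n + 3. ?f k)"
    by (rule num_jacobi_av312_eq_sum_jlast) simp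
  also have "\<dots> = (\<Sum>k\<in>insert 1 ((\<lambda>i. 2 * i + 2) ` {0..n}). ?f k)"
  proof (rule sum.mono_neutral_right)
    show "\<forall>k\<in>{1..2 * n + 3} - insert 1 ((\<lambda>i. 2 * i + 2) ` {0..n}). ?f k = 0"
    proof
      fix k assume k: "k \<in> {1..2 * n + 3} - insert 1 ((\<lambda>i. 2 * i + 2) ` {0..n})"
      have "odd k"
      proof
        assume "even k"
        then obtain i where i: "k = 2 * i" by (auto elim: evenE)
        with k have "k = 2 * (i - 1) + 2" "i - 1 \<in> {0..n}" by auto
        with k show False by blast
      qed
      then show "?f k = 0" using k by (auto simp: jlast_312 simp del: One_nat_def)
    qed
  qed auto
  also have "\<dots> = ?f 1 + (\<Sum>k\<in>(\<lambda>i. 2 * i + 2) ` {0..n}. ?f k)"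
    by (rule sum.insert) auto
  also have "(\<Sum>k\<in>(\<lambda>i. 2 * i + 2) ` {0..n}. ?f k) = (\<Sum>i=0..n. ?f (2 * i + 2))"
    by (subst sum.reindex) (auto simp: inj_on_def)
  also have "\<dots> = (\<Sum>i=0..n. num_jacobi_av312 (2 * i + 1) * num_jacobi_av312 (2 * (n - i) + 1))"
  proof (rule sum.cong)
    fix i assume "i \<in> {0..n}"
    then have "2 * n + 3 - (2 * i + 2) = 2 * (n - i) + 1" by auto
    then show "?f (2 * i + 2) = num_jacobi_av312 (2 * i + 1) * num_jacobi_av312 (2 * (n - i) + 1)"
      using \<open>i \<in> {0..n}\<close> by (simp add: jlast_312 flip: One_nat_def) (simp add: One_nat_def)
  qed simp
  also have "?f 1 = num_jacobi_av312 (2 * n + 2)"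
    by (simp add: jlast_312 num_jacobi_av312_0 del: One_nat_def)
  finally show ?thesis .
qed

lemma num_jacobi_av312_1: "num_jacobi_av312 1 = 1"
proof -
  have "num_jacobi_av312 1 = jlast [3, 1, 2] 1 1"
    using num_jacobi_av312_eq_sum_jlast[of 1] by (simp only: atLeastAtMost_singleton) simp
  also have "\<dots> = 1" unfolding jlast_312 by (simp add: num_jacobi_av312_0)
  finally show ?thesis .
qed

section \<open>Algebra and differential equations of the two series\<close>

context
  fixes E F :: "'a::field_char_0 fps"
  assumes E: "E = 1 + fps_X * (E * F)" and F: "F = E + fps_X * (F * F)"
begin

text \<open>With z = \<open>fps_X\<close>, the equations read E (1 - zF) = 1 and F (1 - zF) = E.
  Multiplying the first by F and the second by E makes their left sides equal.\<close>

lemma fps_ternary_square: "F = E * E"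
proof -
  have "F * (E - fps_X * (E * F)) = E * (F - fps_X * (F * F))" by (simp add: algebra_simps)
  moreover have "E - fps_X * (E * F) = 1" using E by (metis add_diff_cancel_right')
  moreover have "F - fps_X * (F * F) = E" using F by (metis add_diff_cancel_right')
  ultimately show ?thesis by simp
qed

text \<open>This is the functional equation of the Fuss-Catalan series of ternary trees. Below it
  serves to eliminate z by replacing z E^3 with E - 1.\<close>

lemma fps_ternary_eq: "E = 1 + fps_X * (E * E * E)"
  using E by (simp add: fps_ternary_square mult.assoc)

lemma fps_ternary_nonzero: "E \<noteq> 0"
  using fps_ternary_eq by auto

text \<open>Differentiating the cubic gives E' = E^3 + 3 z E^2 E'. Multiplying by E turns the factor
  z E^2 into z E^3 = E - 1.\<close>

lemma fps_ternary_deriv: "fps_deriv E * (3 - 2 * E) = E * E * E * E"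
proof -
  have "fps_deriv E = fps_deriv (1 + fps_X * (E * E * E))" using fps_ternary_eq by simp
  also have "\<dots> = E * E * E + 3 * fps_X * (E * E * fps_deriv E)"
    by (simp add: algebra_simps)
  finally have D: "fps_deriv E = E * E * E + 3 * fps_X * (E * E * fps_deriv E)" .
  have "E * fps_deriv E = E * E * E * E + 3 * (fps_X * (E * E * E)) * fps_deriv E"
    by (subst D) (simp add: algebra_simps)
  also have "fps_X * (E * E * E) = E - 1" using fps_ternary_eq by (metis add_diff_cancel_left')
  finally show ?thesis by (simp add: algebra_simps)
qed

text \<open>Being linear in E and F, this relates single coefficients: it compares F_n with E_n. It
  is z times \<open>fps_ternary_deriv\<close>, rewritten with z E^4 = E (E - 1) and F = E^2.\<close>

lemma fps_ternary_ode1: "fps_deriv (fps_X * F) = 3 * fps_X * fps_deriv E + E"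
proof -
  have X: "fps_X * (E * E * E) = E - 1" using fps_ternary_eq by (metis add_diff_cancel_left')
  have "fps_X * (fps_deriv E * (3 - 2 * E)) = E * (fps_X * (E * E * E))"
    by (simp only: fps_ternary_deriv) (simp add: algebra_simps)
  then have "fps_X * (fps_deriv E * (3 - 2 * E)) = E * (E - 1)" by (simp only: X)
  then show ?thesis by (simp add: fps_ternary_square algebra_simps)
qed

text \<open>The counterpart of \<open>fps_ternary_ode1\<close> comparing E_(n+1) with F_n. The
  product EF does no harm, since z E F = E - 1 makes it a shift of E.\<close>

lemma fps_ternary_ode2:
  "4 * fps_deriv E + 2 * (E * F) = 9 * fps_X * fps_deriv F + 6 * F"
proof -
  have X: "fps_X * (E * E * E) = E - 1" using fps_ternary_eq by (metis add_diff_cancel_left')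
  let ?D = "fps_deriv E"
  \<comment> \<open>The factor E^2 completes z E E' (from z F') to z E^3 E', so that z can be
    eliminated; the result is a multiple of \<open>fps_ternary_deriv\<close>. At the end E^2 is
    cancelled, as E is nonzero.\<close>
  have "E * E * (4 * ?D + 2 * (E * F) - (9 * fps_X * fps_deriv F + 6 * F)) =
      4 * (E * E) * ?D - 18 * (fps_X * (E * E * E)) * ?D + 2 * E * (E * E * E * E) - 6 * (E * E * E * E)"
    by (simp add: fps_ternary_square algebra_simps)
  also have "\<dots> = (6 - 2 * E) * (?D * (3 - 2 * E) - E * E * E * E)"
    by (simp only: X) (simp add: algebra_simps)
  also have "\<dots> = 0" by (simp add: fps_ternary_deriv)
  finally show ?thesis using fps_ternary_nonzero by simp
qed

end

section \<open>Closed forms for the counting sequence\<close>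

definition jacobi_even_fps :: "real fps" where
  "jacobi_even_fps = Abs_fps (\<lambda>n. real (num_jacobi_av312 (2 * n)))"

definition jacobi_odd_fps :: "real fps" where
  "jacobi_odd_fps = Abs_fps (\<lambda>n. real (num_jacobi_av312 (2 * n + 1)))"

lemma jacobi_even_fps_eq: "jacobi_even_fps = 1 + fps_X * (jacobi_even_fps * jacobi_odd_fps)"
proof (rule fps_ext)
  fix n show "fps_nth jacobi_even_fps n = fps_nth (1 + fps_X * (jacobi_even_fps * jacobi_odd_fps)) n"
  proof (cases n)
    case 0 then show ?thesis by (simp add: jacobi_even_fps_def num_jacobi_av312_0)
  next
    case (Suc m)
    then show ?thesis using num_jacobi_av312_even[of m]
      by (simp add: fps_X_mult_nth) (simp add: jacobi_even_fps_def jacobi_odd_fps_def fps_mult_nth)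
  qed
qed

lemma jacobi_odd_fps_eq: "jacobi_odd_fps = jacobi_even_fps + fps_X * (jacobi_odd_fps * jacobi_odd_fps)"
proof (rule fps_ext)
  fix n show "fps_nth jacobi_odd_fps n =
    fps_nth (jacobi_even_fps + fps_X * (jacobi_odd_fps * jacobi_odd_fps)) n"
  proof (cases n)
    case 0 then show ?thesis using num_jacobi_av312_0 num_jacobi_av312_1
      by (simp add: jacobi_even_fps_def jacobi_odd_fps_def)
  next
    case (Suc m)
    then show ?thesis using num_jacobi_av312_odd[of m]
      by (simp add: fps_X_mult_nth)
        (simp add: jacobi_even_fps_def jacobi_odd_fps_def fps_mult_nth numeral_3_eq_3)
  qed
qed

lemma num_jacobi_av312_odd_rec:
  "(real n + 1) * real (num_jacobi_av312 (2 * n + 1)) = (3 * real n + 1) * real (num_jacobi_av312 (2 * n))"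
proof -
  have "fps_nth (fps_deriv (fps_X * jacobi_odd_fps)) n =
    fps_nth (fps_const 3 * (fps_X * fps_deriv jacobi_even_fps) + jacobi_even_fps) n"
    by (simp only: fps_ternary_ode1[OF jacobi_even_fps_eq jacobi_odd_fps_eq] mult.assoc fps_numeral_fps_const)
  then show ?thesis
    by (cases n) (simp_all add: jacobi_even_fps_def jacobi_odd_fps_def algebra_simps)
qed

lemma num_jacobi_av312_even_rec:
  "(4 * real n + 6) * real (num_jacobi_av312 (2 * n + 2)) =
    (9 * real n + 6) * real (num_jacobi_av312 (2 * n + 1))"
proof -
  have "fps_nth (fps_const 4 * fps_deriv jacobi_even_fps +
      fps_const 2 * (jacobi_even_fps * jacobi_odd_fps)) n =
    fps_nth (fps_const 9 * (fps_X * fps_deriv jacobi_odd_fps) + fps_const 6 * jacobi_odd_fps) n"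
    using fps_ternary_ode2[OF jacobi_even_fps_eq jacobi_odd_fps_eq]
    by (simp only: mult.assoc fps_numeral_fps_const)
  \<comment> \<open>The convolution collapses to one coefficient, contributing 2 to the factor 4(n +
    1) + 2 = 4n + 6.\<close>
  moreover have "fps_nth (jacobi_even_fps * jacobi_odd_fps) n = fps_nth jacobi_even_fps (Suc n)"
    by (subst (2) jacobi_even_fps_eq) simp
  ultimately show ?thesis
    by (cases n) (simp_all add: jacobi_even_fps_def jacobi_odd_fps_def algebra_simps)
qed

text \<open>The two recurrences alternate, leading from J(2n) to J(2n + 1) to J(2n + 2), so both
  formulas go through one induction.\<close>

lemma num_jacobi_av312_closed_fact:
  "real (num_jacobi_av312 (2 * n)) = fact (3 * n) / (fact n * fact (2 * n + 1)) \<and>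
   real (num_jacobi_av312 (2 * n + 1)) = fact (3 * n + 1) / (fact (n + 1) * fact (2 * n + 1))"
proof (induction n)
  case 0
  then show ?case using num_jacobi_av312_0 num_jacobi_av312_1 by simp
next
  case (Suc n)
  have odd: "real (num_jacobi_av312 (2 * k + 1)) = fact (3 * k + 1) / (fact (k + 1) * fact (2 * k + 1))"
    if "real (num_jacobi_av312 (2 * k)) = fact (3 * k) / (fact k * fact (2 * k + 1))" for k
  proof -
    have "real (num_jacobi_av312 (2 * k + 1)) = (3 * real k + 1) / (real k + 1) * real (num_jacobi_av312 (2 * k))"
      using num_jacobi_av312_odd_rec[of k] by (simp add: field_simps)
    also have "\<dots> = fact (3 * k + 1) / (fact (k + 1) * fact (2 * k + 1))"
      unfolding that by (simp add: algebra_simps del: fact_Suc) (simp add: field_simps)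
    finally show ?thesis .
  qed
  \<comment> \<open>The quotient of the extra factors, (3n + 3)(3n + 2) / ((2n + 3)(2n + 2)), equals
    (9n + 6) / (4n + 6).\<close>
  have e: "(fact (3 * n + 3) :: real) = (3 * real n + 3) * (3 * real n + 2) * fact (3 * n + 1)"
    "(fact (2 * n + 3) :: real) = (2 * real n + 3) * (2 * real n + 2) * fact (2 * n + 1)"
    by (simp_all add: eval_nat_numeral algebra_simps)
  have "real (num_jacobi_av312 (2 * n + 2)) =
      (9 * real n + 6) / (4 * real n + 6) * real (num_jacobi_av312 (2 * n + 1))"
    using num_jacobi_av312_even_rec[of n] by (simp add: field_simps)
  also have "\<dots> = fact (3 * n + 3) / (fact (n + 1) * fact (2 * n + 3))"
    unfolding conjunct2[OF Suc.IH] e by (simp add: divide_simps del: fact_Suc) (simp add: algebra_simps)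
  finally have ev: "real (num_jacobi_av312 (2 * Suc n)) =
      fact (3 * Suc n) / (fact (Suc n) * fact (2 * Suc n + 1))"
    by (simp add: eval_nat_numeral del: fact_Suc)
  show ?case using ev odd[OF ev] by blast
qed

lemma num_jacobi_av312_even_closed:
  "real (num_jacobi_av312 (2 * n)) = real ((3 * n) choose n) / (2 * real n + 1)"
proof -
  have "3 * n - n = 2 * n" by simp
  then have "real ((3 * n) choose n) = fact (3 * n) / (fact n * fact (2 * n))"
    using binomial_fact[of n "3 * n", where 'a = real] by simp
  then show ?thesis using num_jacobi_av312_closed_fact[of n] by simp
qed

lemma num_jacobi_av312_odd_closed:
  "real (num_jacobi_av312 (2 * n + 1)) = real ((3 * n + 1) choose (n + 1)) / (2 * real n + 1)"
proof -
  have "3 * n + 1 - (n + 1) = 2 * n" by simp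
  then show ?thesis
    using num_jacobi_av312_closed_fact[of n] binomial_fact[of "n + 1" "3 * n + 1", where 'a = real]
    by (simp add: field_simps)
qed

theorem theorem4p8:
  shows "(\<forall>n k::nat. 1 \<le> k \<and> k \<le> n \<longrightarrow>
            real (jlast [3, 1, 2] (2 * n) (2 * k - 1)) =
              real ((3 * k - 3) choose (k - 1)) * real ((3 * n - 3 * k + 1) choose (n - k + 1))
                / ((2 * real k - 1) * (2 * real n - 2 * real k + 1))
          \<and> real (jlast [3, 1, 2] (2 * n + 1) (2 * k)) =
              real ((3 * k - 2) choose k) * real ((3 * n - 3 * k + 1) choose (n - k + 1))
                / ((2 * real k - 1) * (2 * real n - 2 * real k + 1)))
       \<and> (\<forall>n::nat. real (jlast [3, 1, 2] (2 * n + 1) 1) =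
              1 / (2 * real n + 1) * real ((3 * n) choose n))
       \<and> (\<forall>n k::nat. k \<noteq> 1 \<longrightarrow> (even n \<longleftrightarrow> even k) \<longrightarrow> jlast [3, 1, 2] n k = 0)"
proof (intro conjI allI impI)
  fix n k :: nat
  assume "1 \<le> k \<and> k \<le> n"
  \<comment> \<open>Setting k = i + 1 and n = i + 1 + j removes the subtractions: in both formulas
    2j + 1 letters exceed the last one, and 2i or 2i + 1 lie below it.\<close>
  then obtain i j where k: "k = i + 1" and n: "n = i + 1 + j"
    by (metis add.commute le_Suc_ex)
  have idx: "3 * n - 3 * k + 1 = 3 * j + 1" "n - k + 1 = j + 1" "3 * k - 3 = 3 * i" "k - 1 = i"
    "3 * k - 2 = 3 * i + 1" "2 * n - (2 * k - 1) = 2 * j + 1" "2 * k - 1 - 1 = 2 * i"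
    "2 * n + 1 - 2 * k = 2 * j + 1" "2 * k - 1 = 2 * i + 1"
    and den: "2 * real k - 1 = 2 * real i + 1" "2 * real n - 2 * real k + 1 = 2 * real j + 1"
    unfolding k n by simp_all
  have "jlast [3, 1, 2] (2 * n) (2 * k - 1) = num_jacobi_av312 (2 * i) * num_jacobi_av312 (2 * j + 1)"
    unfolding jlast_312 idx(6,7) using k n by simp
  then show "real (jlast [3, 1, 2] (2 * n) (2 * k - 1)) =
      real ((3 * k - 3) choose (k - 1)) * real ((3 * n - 3 * k + 1) choose (n - k + 1))
        / ((2 * real k - 1) * (2 * real n - 2 * real k + 1))"
    unfolding idx den
    by (simp only: of_nat_mult num_jacobi_av312_even_closed num_jacobi_av312_odd_closed times_divide_times_eq)
  have "jlast [3, 1, 2] (2 * n + 1) (2 * k) = num_jacobi_av312 (2 * i + 1) * num_jacobi_av312 (2 * j + 1)"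
    unfolding jlast_312 idx(8,9) using k n by simp
  then show "real (jlast [3, 1, 2] (2 * n + 1) (2 * k)) =
      real ((3 * k - 2) choose k) * real ((3 * n - 3 * k + 1) choose (n - k + 1))
        / ((2 * real k - 1) * (2 * real n - 2 * real k + 1))"
    unfolding idx den
    by (simp only: k of_nat_mult num_jacobi_av312_odd_closed times_divide_times_eq)
next
  fix n :: nat
  show "real (jlast [3, 1, 2] (2 * n + 1) 1) = 1 / (2 * real n + 1) * real ((3 * n) choose n)"
    by (simp add: jlast_312 num_jacobi_av312_0 num_jacobi_av312_even_closed del: One_nat_def)
next
  fix n k :: nat
  assume "k \<noteq> 1" "even n \<longleftrightarrow> even k"
  \<comment> \<open>For k in range, n - k is even; any other k is no letter of the word.\<close>
  then show "jlast [3, 1, 2] n k = 0" by (auto simp: jlast_312 simp del: One_nat_def)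
qed

end
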